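(* Let $\theta\in(0,1)$ be an irrational number and let $A_\theta$ be the universal $C^*$-algebra generated by unitaries $u,v$ with $vu=e^{2\pi i\theta}uv$. For $0<\lambda\leq 1$, the spectral radius of $u+\lambda v$ satisfies $r(u+\lambda v)=1$.
   Context: $r(T)=\lim_{n\to\infty}\|T^n\|^{1/n}$ denotes the spectral radius of $T$. *)

theory Defs
  imports Complex_Main "HOL-Algebra.Module" "HOL-Algebra.Algebraic_Closure_Type"
begin

record 'a cstar = "(complex, 'a) module" +
  star :: "'a \<Rightarrow> 'a"  (\<open>_\<star>\<index>\<close> [1000] 999)
  cnorm :: "'a \<Rightarrow> real"  (\<open>\<parallel>_\<parallel>\<index>\<close>)

(* As usual for unital Banach algebras the zero algebra is excluded; given the other axioms,
   one_not_zero is equivalent to the normalisation that the unit has norm 1. *)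
locale unital_cstar_algebra =
  ring A + module "ring_of_type_algebra :: complex ring" A
  for A :: "('a, 'm) cstar_scheme" (structure) +
  assumes one_not_zero: "\<one> \<noteq> \<zero>"
    and smult_mult_left:
      "\<lbrakk>x \<in> carrier A; y \<in> carrier A\<rbrakk> \<Longrightarrow> (c \<odot> x) \<otimes> y = c \<odot> (x \<otimes> y)"
    and smult_mult_right:
      "\<lbrakk>x \<in> carrier A; y \<in> carrier A\<rbrakk> \<Longrightarrow> x \<otimes> (c \<odot> y) = c \<odot> (x \<otimes> y)"
    and star_closed: "x \<in> carrier A \<Longrightarrow> x\<star> \<in> carrier A"
    and star_star: "x \<in> carrier A \<Longrightarrow> (x\<star>)\<star> = x"
    and star_add: "\<lbrakk>x \<in> carrier A; y \<in> carrier A\<rbrakk> \<Longrightarrow> (x \<oplus> y)\<star> = x\<star> \<oplus> y\<star>"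
    and star_smult: "x \<in> carrier A \<Longrightarrow> (c \<odot> x)\<star> = cnj c \<odot> x\<star>"
    and star_mult: "\<lbrakk>x \<in> carrier A; y \<in> carrier A\<rbrakk> \<Longrightarrow> (x \<otimes> y)\<star> = y\<star> \<otimes> x\<star>"
    and norm_nonneg: "x \<in> carrier A \<Longrightarrow> 0 \<le> \<parallel>x\<parallel>"
    and norm_eq_zero: "x \<in> carrier A \<Longrightarrow> \<parallel>x\<parallel> = 0 \<longleftrightarrow> x = \<zero>"
    and norm_add: "\<lbrakk>x \<in> carrier A; y \<in> carrier A\<rbrakk> \<Longrightarrow> \<parallel>x \<oplus> y\<parallel> \<le> \<parallel>x\<parallel> + \<parallel>y\<parallel>"
    and norm_smult: "x \<in> carrier A \<Longrightarrow> \<parallel>c \<odot> x\<parallel> = cmod c * \<parallel>x\<parallel>"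
    and norm_mult: "\<lbrakk>x \<in> carrier A; y \<in> carrier A\<rbrakk> \<Longrightarrow> \<parallel>x \<otimes> y\<parallel> \<le> \<parallel>x\<parallel> * \<parallel>y\<parallel>"
    and cstar_identity: "x \<in> carrier A \<Longrightarrow> \<parallel>x\<star> \<otimes> x\<parallel> = \<parallel>x\<parallel>\<^sup>2"
    and complete:
      "\<lbrakk>\<And>n::nat. s n \<in> carrier A;
        \<And>e::real. e > 0 \<Longrightarrow> \<exists>N. \<forall>m\<ge>N. \<forall>n\<ge>N. \<parallel>s m \<ominus> s n\<parallel> < e\<rbrakk>
       \<Longrightarrow> \<exists>x\<in>carrier A. (\<lambda>n. \<parallel>s n \<ominus> x\<parallel>) \<longlonglongrightarrow> 0"

definition unitary :: "('a, 'm) cstar_scheme \<Rightarrow> 'a \<Rightarrow> bool" where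
  "unitary A u \<longleftrightarrow> u \<in> carrier A
     \<and> u\<star>\<^bsub>A\<^esub> \<otimes>\<^bsub>A\<^esub> u = \<one>\<^bsub>A\<^esub> \<and> u \<otimes>\<^bsub>A\<^esub> u\<star>\<^bsub>A\<^esub> = \<one>\<^bsub>A\<^esub>"

inductive_set star_subalgebra_gen :: "('a, 'm) cstar_scheme \<Rightarrow> 'a set \<Rightarrow> 'a set"
  for A :: "('a, 'm) cstar_scheme" and S :: "'a set" where
  base: "x \<in> S \<Longrightarrow> x \<in> star_subalgebra_gen A S"
| add: "\<lbrakk>x \<in> star_subalgebra_gen A S; y \<in> star_subalgebra_gen A S\<rbrakk>
        \<Longrightarrow> x \<oplus>\<^bsub>A\<^esub> y \<in> star_subalgebra_gen A S"
| mult: "\<lbrakk>x \<in> star_subalgebra_gen A S; y \<in> star_subalgebra_gen A S\<rbrakk>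
        \<Longrightarrow> x \<otimes>\<^bsub>A\<^esub> y \<in> star_subalgebra_gen A S"
| smult: "x \<in> star_subalgebra_gen A S \<Longrightarrow> c \<odot>\<^bsub>A\<^esub> x \<in> star_subalgebra_gen A S"
| star: "x \<in> star_subalgebra_gen A S \<Longrightarrow> x\<star>\<^bsub>A\<^esub> \<in> star_subalgebra_gen A S"

definition generates_cstar :: "('a, 'm) cstar_scheme \<Rightarrow> 'a set \<Rightarrow> bool" where
  "generates_cstar A S \<longleftrightarrow> S \<subseteq> carrier A \<and>
     (\<forall>x\<in>carrier A. \<forall>e>0. \<exists>y\<in>star_subalgebra_gen A S. \<parallel>x \<ominus>\<^bsub>A\<^esub> y\<parallel>\<^bsub>A\<^esub> < e)"

definition star_hom :: "('a, 'm) cstar_scheme \<Rightarrow> ('b, 'n) cstar_scheme \<Rightarrow> ('a \<Rightarrow> 'b) set" where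
  "star_hom A B = {h \<in> ring_hom A B.
     (\<forall>c. \<forall>x\<in>carrier A. h (c \<odot>\<^bsub>A\<^esub> x) = c \<odot>\<^bsub>B\<^esub> h x) \<and>
     (\<forall>x\<in>carrier A. h (x\<star>\<^bsub>A\<^esub>) = (h x)\<star>\<^bsub>B\<^esub>)}"

definition rotation_pair :: "real \<Rightarrow> ('a, 'm) cstar_scheme \<Rightarrow> 'a \<Rightarrow> 'a \<Rightarrow> bool" where
  "rotation_pair \<theta> A u v \<longleftrightarrow> unitary A u \<and> unitary A v \<and>
     v \<otimes>\<^bsub>A\<^esub> u = exp (2 * of_real pi * \<i> * of_real \<theta>) \<odot>\<^bsub>A\<^esub> (u \<otimes>\<^bsub>A\<^esub> v)"

(* The test algebras B range over all C*-algebra structures on subsets of the type 'a underlying A.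
   This loses nothing: the image of a homomorphism out of A lies in the C*-subalgebra generated
   by U and V, which is separable and so has at most continuum many elements, while 'a contains
   the scalar multiples of the unit of A; hence that subalgebra has an isomorphic copy on 'a.
   The homomorphism is unique on the carrier of A because u and v generate A. *)
definition universal_rotation_algebra :: "real \<Rightarrow> 'a cstar \<Rightarrow> 'a \<Rightarrow> 'a \<Rightarrow> bool" where
  "universal_rotation_algebra \<theta> A u v \<longleftrightarrow>
     unital_cstar_algebra A \<and> rotation_pair \<theta> A u v \<and> generates_cstar A {u, v} \<and>
     (\<forall>(B :: 'a cstar) U V. unital_cstar_algebra B \<and> rotation_pair \<theta> B U V \<longrightarrow>
        (\<exists>h\<in>star_hom A B. h u = U \<and> h v = V))"

(* The value for n = 0 is irrelevant (root 0 is constantly 0). *)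
definition spectral_radius :: "('a, 'm) cstar_scheme \<Rightarrow> 'a \<Rightarrow> real" where
  "spectral_radius A T = lim (\<lambda>n::nat. root n \<parallel>T [^]\<^bsub>A\<^esub> n\<parallel>\<^bsub>A\<^esub>)"

end

theory Submission
  imports Defs "HOL-Complex_Analysis.Cauchy_Integral_Formula"
begin

text \<open>With the unitary \<open>x = v u\<star>\<close> and \<open>q = exp (- 2 \<pi> i \<theta>)\<close> one has \<open>u x = q x u\<close>, hence
  \<open>(u + \<lambda> v)\<^sup>n = P\<^sub>n(x) u\<^sup>n\<close> with \<open>P\<^sub>n(z) = \<Prod>k<n. 1 + \<lambda> q\<^sup>k z\<close>, and its norm is that of \<open>P\<^sub>n(x)\<close>.
  Averaging the conjugates of \<open>P\<^sub>n(x)\<close> by powers of \<open>u\<close> gives the lower bound \<open>\<bar>P\<^sub>n(0)\<bar> = 1\<close>. In the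
  other direction the norm is at most the sum of the \<open>n + 1\<close> absolute coefficients, so by Cauchy's
  inequality at most \<open>n + 1\<close> times the maximum of \<open>\<bar>P\<^sub>n\<bar>\<close> on the unit circle. That maximum grows
  subexponentially by equidistribution of the orbit of an irrational rotation, and the polynomial
  factor disappears in the \<open>n\<close>-th root, so the spectral theory of \<open>x\<close> is not needed.\<close>

section \<open>Analytic estimates on the unit circle\<close>

text \<open>The coefficient is the \<open>k\<close>-th derivative at 0 divided by \<open>k!\<close>,
  which Cauchy's inequality controls on the circle of radius 1.\<close>

lemma norm_coeff_le_circle_bound:
  fixes p :: "complex poly"
  assumes "\<And>z. cmod z = 1 \<Longrightarrow> cmod (poly p z) \<le> B"
  shows "cmod (Polynomial.coeff p k) \<le> B"
proof -
  have deriv_poly: "(deriv ^^ k) (poly p) = poly ((pderiv ^^ k) p)"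
  proof (induction k)
    case (Suc k)
    then show ?case
      by (auto intro!: DERIV_imp_deriv poly_DERIV)
  qed simp
  have "cmod ((deriv ^^ k) (poly p) 0) \<le> fact k * B / 1 ^ k"
    by (rule Cauchy_inequality) (auto intro!: holomorphic_intros continuous_intros assms)
  moreover have "(deriv ^^ k) (poly p) 0 = fact k * Polynomial.coeff p k"
    by (simp add: deriv_poly poly_0_coeff_0 coeff_higher_pderiv pochhammer_fact)
  ultimately show ?thesis
    by (simp add: norm_mult)
qed

text \<open>In the difference of the squared sides the terms in \<open>(cmod z)\<^sup>2\<close>
  cancel, leaving a product that is nonnegative because \<open>Re z\<close> is at least -1. The
  lemma trades a factor \<open>1/r\<close> for an argument inside the disc of radius
  \<open>r\<close>.\<close>

lemma norm_one_plus_shrink: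
  fixes z :: complex and r :: real
  assumes "0 < r" "r < 1" "cmod z \<le> 1"
  shows "r * cmod (1 + z) \<le> cmod (1 + of_real r * z)"
proof -
  have "- Re z \<le> 1"
    using abs_Re_le_cmod[of z] assms by linarith
  then have *: "0 \<le> 1 + r + 2 * (r * Re z)"
    using assms mult_left_mono[of "- Re z" 1 r] by simp
  have "(cmod (1 + of_real r * z))\<^sup>2 - (r * cmod (1 + z))\<^sup>2 = (1 - r) * (1 + r + 2 * (r * Re z))"
    unfolding power_mult_distrib cmod_power2 by (simp add: power2_eq_square algebra_simps)
  also have "\<dots> \<ge> 0"
    using * assms by simp
  finally have "(r * cmod (1 + z))\<^sup>2 \<le> (cmod (1 + of_real r * z))\<^sup>2"
    by (simp only: diff_ge_0_iff_ge)
  then show ?thesis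
    by (rule power2_le_imp_le) (rule norm_ge_zero)
qed

text \<open>The modulus of \<open>1 + z\<close> is \<open>exp (Re (ln (1 + z)))\<close>, and the
  power series of the logarithm converges uniformly on the closed disc of radius
  \<open>r < 1\<close>, so one truncation \<open>K\<close> serves all \<open>z\<close>.\<close>

lemma norm_one_plus_le_exp_truncated_log:
  fixes r e :: real
  assumes "0 < r" "r < 1" "0 < e"
  obtains K where
    "\<And>z. cmod z \<le> r \<Longrightarrow> cmod (1 + z) \<le> exp (Re (\<Sum>m<K. (-1) ^ Suc m / of_nat m * z ^ m) + e)"
proof -
  \<comment> \<open>At \<open>m = 0\<close> the division by zero yields 0, which is the correct
    constant term of the logarithm series.\<close>
  let ?f = "\<lambda>m z. (-1) ^ Suc m / of_nat m * z ^ m :: complex"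
  have bound: "cmod (?f m z) \<le> r ^ m" if "z \<in> cball 0 r" for m z
  proof (cases "m = 0")
    case False
    have "cmod (?f m z) = cmod z ^ m / real m"
      by (simp add: norm_mult norm_divide norm_power)
    also have "\<dots> \<le> cmod z ^ m / 1"
      using False by (intro divide_left_mono) auto
    also have "\<dots> \<le> r ^ m"
      using that by (simp add: power_mono)
    finally show ?thesis .
  qed simp
  have "uniform_limit (cball 0 r) (\<lambda>n z. \<Sum>m<n. ?f m z) (\<lambda>z. \<Sum>m. ?f m z) sequentially"
    using bound assms by (intro Weierstrass_m_test[where M = "\<lambda>m. r ^ m"]) (auto simp: summable_geometric)
  then obtain K where K: "dist (\<Sum>m<K. ?f m z) (\<Sum>m. ?f m z) < e" if "z \<in> cball 0 r" for z
    using \<open>0 < e\<close> unfolding uniform_limit_iff eventually_sequentially by blast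
  show thesis
  proof
    fix z :: complex
    assume z: "cmod z \<le> r"
    then have "cmod z < 1" using assms by simp
    then have "(\<Sum>m. ?f m z) = ln (1 + z)"
      using Ln_series sums_unique by metis
    moreover have "z \<in> cball 0 r" using z by simp
    ultimately have "cmod (ln (1 + z) - (\<Sum>m<K. ?f m z)) < e"
      using K[of z] by (simp add: dist_norm norm_minus_commute)
    then have "Re (ln (1 + z)) \<le> Re (\<Sum>m<K. ?f m z) + e"
      using abs_Re_le_cmod[of "ln (1 + z) - (\<Sum>m<K. ?f m z)"] by simp
    moreover have "1 + z \<noteq> 0"
      using \<open>cmod z < 1\<close> by (metis add_eq_0_iff norm_minus_cancel norm_one less_irrefl)
    then have "cmod (1 + z) = exp (Re (ln (1 + z)))"
      using norm_exp_eq_Re[of "ln (1 + z)"] by simp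
    ultimately show "cmod (1 + z) \<le> exp (Re (\<Sum>m<K. ?f m z) + e)"
      by (simp only: exp_le_cancel_iff)
  qed
qed

text \<open>The bound does not depend on \<open>n\<close>; this is the quantitative form of
  equidistribution, applied to each frequency separately.\<close>

lemma norm_geometric_sum_le:
  fixes z :: complex
  assumes "cmod z = 1" "z \<noteq> 1"
  shows "cmod (\<Sum>k<n. z ^ k) \<le> 2 / cmod (1 - z)"
proof -
  have "cmod (1 - z ^ n) \<le> 2"
    using norm_triangle_ineq4[of 1 "z ^ n"] assms by (simp add: norm_power)
  then show ?thesis
    using assms by (simp add: sum_gp_strict norm_divide divide_right_mono)
qed

text \<open>The exponential growth rate is \<open>\<integral> log \<bar>1 + c z\<bar>\<close> over the circle, which vanishes for
  \<open>\<bar>c\<bar> \<le> 1\<close>. Shrinking the radius avoids the singularity of the logarithm at \<open>\<bar>c\<bar> = 1\<close>.\<close>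

lemma rotation_product_subexponential:
  fixes q :: complex and lam e :: real
  assumes q: "cmod q = 1" "\<And>m. 0 < m \<Longrightarrow> q ^ m \<noteq> 1"
    and lam: "0 \<le> lam" "lam \<le> 1" and "0 < e"
  obtains C where "0 < C"
    "\<And>n z. cmod z = 1 \<Longrightarrow> (\<Prod>k<n. cmod (1 + of_real lam * q ^ k * z)) \<le> C * exp (e * real n)"
proof -
  \<comment> \<open>Half of \<open>e\<close> pays for the shrinking factor
    \<open>1/r = exp (e / 2)\<close>, the other half for truncating the logarithm.\<close>
  define r where "r = exp (- (e / 2))"
  have r: "0 < r" "r < 1"
    using \<open>0 < e\<close> by (auto simp: r_def)
  let ?a = "\<lambda>m::nat. (-1) ^ Suc m / of_nat m :: complex"
  obtain K where K: "\<And>z. cmod z \<le> r \<Longrightarrow> cmod (1 + z) \<le> exp (Re (\<Sum>m<K. ?a m * z ^ m) + e / 2)"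
    using norm_one_plus_le_exp_truncated_log[of r "e / 2"] r \<open>0 < e\<close> by auto
  \<comment> \<open>The term at \<open>m = 0\<close> is 0, since \<open>?a 0\<close> is a division
    by zero. \<open>D\<close> depends neither on \<open>n\<close> nor on \<open>z\<close>.\<close>
  define D where "D = (\<Sum>m<K. cmod (?a m) * (2 / cmod (1 - q ^ m)))"
  show thesis
  proof
    show "0 < exp D" by simp
    fix n :: nat and z :: complex
    assume z: "cmod z = 1"
    define c where "c = of_real r * of_real lam * z"
    have c: "cmod c \<le> r"
      using r lam z by (simp add: c_def norm_mult mult_left_le)
    then have c1: "cmod c \<le> 1"
      using r by simp
    define L where "L k = (\<Sum>m<K. ?a m * (c * q ^ k) ^ m)" for k
    have shift: "exp (s + e / 2) / r = exp (s + e)" for s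
      by (simp add: r_def flip: exp_diff)
    have factor: "cmod (1 + of_real lam * q ^ k * z) \<le> exp (Re (L k) + e)" for k
    proof -
      have "r * cmod (1 + of_real lam * q ^ k * z) \<le> cmod (1 + of_real r * (of_real lam * q ^ k * z))"
        using r lam q z by (intro norm_one_plus_shrink) (auto simp: norm_mult norm_power)
      also have "of_real r * (of_real lam * q ^ k * z) = c * q ^ k"
        by (simp add: c_def)
      also have "cmod (1 + c * q ^ k) \<le> exp (Re (L k) + e / 2)"
        unfolding L_def using c q by (intro K) (simp add: norm_mult norm_power)
      finally have "cmod (1 + of_real lam * q ^ k * z) \<le> exp (Re (L k) + e / 2) / r"
        by (simp only: pos_le_divide_eq[OF r(1)] mult.commute)
      then show ?thesis
        by (simp only: shift)
    qed
    \<comment> \<open>Interchanging the sums turns the orbit sum at each frequency \<open>m\<close>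
      into a geometric sum with ratio \<open>q ^ m\<close>, which differs from 1 for
      \<open>m > 0\<close>.\<close>
    have "?a m * (c * q ^ k) ^ m = ?a m * c ^ m * (q ^ m) ^ k" for m k
      by (simp only: power_mult_distrib mult.assoc power_mult[symmetric] mult.commute[of k m])
    then have "(\<Sum>k<n. L k) = (\<Sum>m<K. ?a m * c ^ m * (\<Sum>k<n. (q ^ m) ^ k))"
      unfolding L_def by (subst sum.swap) (simp only: sum_distrib_left)
    also have "cmod \<dots> \<le> D"
      unfolding D_def
    proof (rule sum_norm_le)
      fix m
      show "cmod (?a m * c ^ m * (\<Sum>k<n. (q ^ m) ^ k)) \<le> cmod (?a m) * (2 / cmod (1 - q ^ m))"
      proof (cases "m = 0")
        case False
        have "cmod (?a m * c ^ m) \<le> cmod (?a m)"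
          unfolding norm_mult norm_power using c1 by (intro mult_left_le power_le_one) auto
        moreover have "cmod (\<Sum>k<n. (q ^ m) ^ k) \<le> 2 / cmod (1 - q ^ m)"
          using q False by (intro norm_geometric_sum_le) (auto simp: norm_power)
        ultimately show ?thesis
          unfolding norm_mult[of "?a m * c ^ m"] by (intro mult_mono) auto
      qed simp
    qed
    finally have D: "Re (\<Sum>k<n. L k) \<le> D"
      using complex_Re_le_cmod order_trans by blast
    have "(\<Prod>k<n. cmod (1 + of_real lam * q ^ k * z)) \<le> (\<Prod>k<n. exp (Re (L k) + e))"
      using factor by (intro prod_mono) auto
    also have "\<dots> = exp (Re (\<Sum>k<n. L k) + e * real n)"
      by (simp add: sum.distrib mult.commute flip: exp_sum)
    also have "\<dots> \<le> exp D * exp (e * real n)"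
      using D by (simp flip: exp_add)
    finally show "(\<Prod>k<n. cmod (1 + of_real lam * q ^ k * z)) \<le> exp D * exp (e * real n)" .
  qed
qed

lemma root_tendsto_1:
  fixes a :: "nat \<Rightarrow> real"
  assumes lower: "\<And>n. 1 \<le> a n"
    and upper: "\<And>e. 0 < e \<Longrightarrow> \<exists>C>0. \<forall>n. a n \<le> real (Suc n) * C * exp (e * real n)"
  shows "(\<lambda>n. root n (a n)) \<longlonglongrightarrow> 1"
proof (rule order_tendstoI)
  fix y :: real
  assume "y < 1"
  \<comment> \<open>The index 0 must be discarded, as \<open>root 0\<close> is constantly 0.\<close>
  show "\<forall>\<^sub>F n in sequentially. y < root n (a n)"
    using eventually_gt_at_top[of 0]
    by eventually_elim (use \<open>y < 1\<close> lower in \<open>auto intro: less_le_trans\<close>)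
next
  fix y :: real
  assume "1 < y"
  \<comment> \<open>Then \<open>exp e\<close> is the square root of \<open>y\<close>, strictly below
    \<open>y\<close>, which leaves room for the subexponential factors.\<close>
  define e where "e = ln y / 2"
  have e: "0 < e" "exp e < y"
    using \<open>1 < y\<close> exp_less_mono[of e "ln y"] by (simp_all add: e_def)
  obtain C where C: "0 < C" "\<And>n. a n \<le> real (Suc n) * C * exp (e * real n)"
    using upper[OF e(1)] by blast
  have "(\<lambda>n. root n (2 * C) * root n (real n) * exp e) \<longlonglongrightarrow> 1 * 1 * exp e"
    using C by (intro tendsto_intros LIMSEQ_root LIMSEQ_root_const) auto
  then have "\<forall>\<^sub>F n in sequentially. root n (2 * C) * root n (real n) * exp e < y"
    using e by (simp add: order_tendsto_iff)
  then show "\<forall>\<^sub>F n in sequentially. root n (a n) < y"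
    using eventually_gt_at_top[of 0]
  proof eventually_elim
    case (elim n)
    have "a n \<le> real (Suc n) * C * exp (e * real n)"
      by (rule C)
    \<comment> \<open>For positive \<open>n\<close>, \<open>Suc n\<close> is at most
      \<open>2 * n\<close>.\<close>
    also have "\<dots> \<le> 2 * C * real n * exp e ^ n"
      using elim(2) C(1) by (auto simp: exp_of_nat_mult[symmetric] mult.commute)
    finally have "root n (a n) \<le> root n (2 * C * real n * exp e ^ n)"
      using elim(2) by simp
    also have "\<dots> = root n (2 * C) * root n (real n) * exp e"
      using elim(2) by (simp add: real_root_mult real_root_power_cancel)
    finally show ?case
      using elim(1) by simp
  qed
qed

section \<open>Arithmetic and unitaries in a unital C*-algebra\<close>

lemma ring_of_type_algebra_simps [simp]:
  "carrier ring_of_type_algebra = UNIV"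
  "x \<oplus>\<^bsub>ring_of_type_algebra\<^esub> y = x + y"
  "x \<otimes>\<^bsub>ring_of_type_algebra\<^esub> y = x * y"
  "\<zero>\<^bsub>ring_of_type_algebra\<^esub> = 0"
  "\<one>\<^bsub>ring_of_type_algebra\<^esub> = 1"
  by (simp_all add: ring_of_type_algebra_def)

context unital_cstar_algebra
begin

text \<open>The locale predicate imports two rings, and the unqualified names of the ring laws refer to
  the scalars, not to \<open>A\<close>.\<close>

lemma mult_assoc:
  "\<lbrakk>x \<in> carrier A; y \<in> carrier A; z \<in> carrier A\<rbrakk> \<Longrightarrow> (x \<otimes> y) \<otimes> z = x \<otimes> (y \<otimes> z)"
  by (rule monoid.m_assoc) unfold_locales

lemma add_mult:
  "\<lbrakk>x \<in> carrier A; y \<in> carrier A; z \<in> carrier A\<rbrakk> \<Longrightarrow> (x \<oplus> y) \<otimes> z = x \<otimes> z \<oplus> y \<otimes> z"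
  by (rule semiring.l_distr) unfold_locales

lemma mult_add:
  "\<lbrakk>x \<in> carrier A; y \<in> carrier A; z \<in> carrier A\<rbrakk> \<Longrightarrow> z \<otimes> (x \<oplus> y) = z \<otimes> x \<oplus> z \<otimes> y"
  by (rule semiring.r_distr) unfold_locales

lemma abelian_monoid_A: "abelian_monoid A"
  by unfold_locales

lemmas plus_ac = abelian_monoid.a_ac[OF abelian_monoid_A]

lemma smult_assoc: "x \<in> carrier A \<Longrightarrow> a \<odot> (b \<odot> x) = (a * b) \<odot> x"
  using smult_assoc1[of a b x] by simp

lemma smult_add: "x \<in> carrier A \<Longrightarrow> (a + b) \<odot> x = a \<odot> x \<oplus> b \<odot> x"
  using smult_l_distr[of a b x] by simp

lemma smult_1 [simp]: "x \<in> carrier A \<Longrightarrow> 1 \<odot> x = x"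
  using smult_one[of x] by simp

lemma smult_0 [simp]: "x \<in> carrier A \<Longrightarrow> 0 \<odot> x = \<zero>"
  using smult_l_null[of x] by simp

lemma star_one: "\<one>\<star> = \<one>"
proof -
  have "\<one>\<star> = (\<one>\<star> \<otimes> \<one>)\<star>"
    by (subst star_mult) (simp_all add: star_closed star_star)
  then show ?thesis
    by (simp add: star_closed star_star)
qed

lemma norm_one [simp]: "\<parallel>\<one>\<parallel> = 1"
proof -
  have "\<parallel>\<one>\<parallel> = \<parallel>\<one>\<parallel>\<^sup>2"
    using cstar_identity[of \<one>] by (simp add: star_one)
  moreover have "\<parallel>\<one>\<parallel> \<noteq> 0"
    using norm_eq_zero one_not_zero by simp
  ultimately show ?thesis
    by (simp add: power2_eq_square)
qed

lemma norm_zero [simp]: "\<parallel>\<zero>\<parallel> = 0"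
  using norm_eq_zero by simp

lemma unitary_star: "unitary A u \<Longrightarrow> unitary A (u\<star>)"
  by (simp add: unitary_def star_closed star_star)

lemma norm_unitary: "unitary A u \<Longrightarrow> \<parallel>u\<parallel> = 1"
  using cstar_identity[of u] norm_nonneg[of u] by (simp add: unitary_def power2_eq_1_iff)

text \<open>Multiplication by \<open>u\<close> and by its inverse, the adjoint, are both
  contractive.\<close>

lemma norm_mult_unitary_left:
  assumes "unitary A u" "x \<in> carrier A"
  shows "\<parallel>u \<otimes> x\<parallel> = \<parallel>x\<parallel>"
proof (rule antisym)
  have u: "u \<in> carrier A" "u\<star> \<in> carrier A"
    using assms by (auto simp: unitary_def star_closed)
  show "\<parallel>u \<otimes> x\<parallel> \<le> \<parallel>x\<parallel>"
    using norm_mult[of u x] assms u by (simp add: norm_unitary)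
  have "\<parallel>u\<star> \<otimes> (u \<otimes> x)\<parallel> \<le> \<parallel>u \<otimes> x\<parallel>"
    using norm_mult[of "u\<star>" "u \<otimes> x"] assms u by (simp add: norm_unitary[OF unitary_star])
  then show "\<parallel>x\<parallel> \<le> \<parallel>u \<otimes> x\<parallel>"
    using assms u by (simp add: unitary_def flip: mult_assoc)
qed

lemma norm_mult_unitary_right:
  assumes "unitary A u" "x \<in> carrier A"
  shows "\<parallel>x \<otimes> u\<parallel> = \<parallel>x\<parallel>"
proof (rule antisym)
  have u: "u \<in> carrier A" "u\<star> \<in> carrier A"
    using assms by (auto simp: unitary_def star_closed)
  show "\<parallel>x \<otimes> u\<parallel> \<le> \<parallel>x\<parallel>"
    using norm_mult[of x u] assms u by (simp add: norm_unitary)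
  have "\<parallel>x \<otimes> u \<otimes> u\<star>\<parallel> \<le> \<parallel>x \<otimes> u\<parallel>"
    using norm_mult[of "x \<otimes> u" "u\<star>"] assms u by (simp add: norm_unitary[OF unitary_star])
  then show "\<parallel>x\<parallel> \<le> \<parallel>x \<otimes> u\<parallel>"
    using assms u by (simp add: unitary_def mult_assoc)
qed

lemma norm_mult_unitary_pow_right:
  assumes "unitary A u" "x \<in> carrier A"
  shows "\<parallel>x \<otimes> u [^] (n::nat)\<parallel> = \<parallel>x\<parallel>"
proof (induction n)
  case (Suc n)
  have "u \<in> carrier A" using assms by (simp add: unitary_def)
  then show ?case
    using Suc assms norm_mult_unitary_right[of u "x \<otimes> u [^] n"] by (simp add: mult_assoc)
qed (use assms in simp)

section \<open>Polynomials in an element of the algebra\<close>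

text \<open>Polynomial functional calculus as a Horner scheme, so that induction along
  \<open>pCons\<close> follows the evaluation.\<close>

definition peval :: "complex poly \<Rightarrow> 'a \<Rightarrow> 'a" where
  "peval p x = fold_coeffs (\<lambda>a y. a \<odot> \<one> \<oplus> x \<otimes> y) p \<zero>"

lemma peval_0 [simp]: "peval 0 x = \<zero>"
  by (simp add: peval_def)

lemma peval_pCons:
  assumes "x \<in> carrier A"
  shows "peval (pCons a p) x = a \<odot> \<one> \<oplus> x \<otimes> peval p x"
  \<comment> \<open>\<open>pCons 0 0\<close> collapses to 0, on which \<open>fold_coeffs\<close>
    makes no step; both sides are then zero.\<close>
  by (cases "p = 0 \<and> a = 0") (use assms in \<open>auto simp: peval_def\<close>)

lemma peval_closed [simp]: "x \<in> carrier A \<Longrightarrow> peval p x \<in> carrier A"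
  by (induction p) (simp_all add: peval_pCons)

lemma peval_const: "x \<in> carrier A \<Longrightarrow> peval [:a:] x = a \<odot> \<one>"
  by (simp add: peval_pCons)

lemma peval_add:
  assumes "x \<in> carrier A"
  shows "peval (p + q) x = peval p x \<oplus> peval q x"
proof (induction p q rule: poly_induct2)
  case (pCons a p b q)
  then show ?case
    using assms by (simp add: peval_pCons smult_add mult_add plus_ac)
qed simp

lemma peval_smult:
  assumes "x \<in> carrier A"
  shows "peval (Polynomial.smult c p) x = c \<odot> peval p x"
proof (induction p)
  case (pCons a p)
  then show ?case
    using assms by (simp add: peval_pCons smult_assoc smult_r_distr smult_mult_right)
qed (simp add: smult_r_null)

text \<open>Multiplicativity for one linear factor, as products are built factor by factor in
  \<open>pow_binomial\<close>. It rests on \<open>x\<close> commuting with polynomials in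
  \<open>x\<close>.\<close>

lemma peval_mult_linear:
  assumes "x \<in> carrier A"
  shows "peval (p * [:1, a:]) x = peval p x \<oplus> a \<odot> (peval p x \<otimes> x)"
proof -
  have comm: "x \<otimes> peval p x = peval p x \<otimes> x"
  proof (induction p)
    case (pCons b p)
    then show ?case
      using assms
      by (simp add: peval_pCons add_mult mult_add smult_mult_left smult_mult_right flip: mult_assoc)
  qed (use assms in simp)
  have "p * [:1, a:] = p + Polynomial.smult a (pCons 0 p)"
    by simp
  then show ?thesis
    using assms comm by (simp only: peval_add peval_smult) (simp add: peval_pCons)
qed

text \<open>Each Horner step multiplies by an element of norm at most 1 and adds one
  coefficient.\<close>

lemma norm_peval_le:
  assumes x: "x \<in> carrier A" "\<parallel>x\<parallel> \<le> 1" and "Polynomial.degree p \<le> d"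
  shows "\<parallel>peval p x\<parallel> \<le> (\<Sum>k\<le>d. cmod (Polynomial.coeff p k))"
  using assms(3)
proof (induction p arbitrary: d)
  case 0
  then show ?case by simp
next
  case (pCons a p)
  have *: "\<parallel>peval (pCons a p) x\<parallel> \<le> cmod a + \<parallel>peval p x\<parallel>"
  proof -
    have "\<parallel>x \<otimes> peval p x\<parallel> \<le> \<parallel>x\<parallel> * \<parallel>peval p x\<parallel>"
      using x by (simp add: norm_mult)
    also have "\<dots> \<le> 1 * \<parallel>peval p x\<parallel>"
      using x by (intro mult_right_mono norm_nonneg) auto
    finally show ?thesis
      using x norm_add[of "a \<odot> \<one>" "x \<otimes> peval p x"] by (simp add: peval_pCons norm_smult)
  qed
  show ?case
  \<comment> \<open>For \<open>p = 0\<close> the bound \<open>d\<close> may itself be 0 and cannot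
    be lowered for the induction hypothesis.\<close>
  proof (cases "p = 0")
    case True
    have "cmod a \<le> (\<Sum>k\<le>d. cmod (Polynomial.coeff (pCons a p) k))"
      by (rule order_trans[OF _ member_le_sum[of 0]]) auto
    then show ?thesis
      using * True by simp
  next
    case False
    then obtain d' where d: "d = Suc d'" "Polynomial.degree p \<le> d'"
      using pCons.prems by (cases d) auto
    have "\<parallel>peval p x\<parallel> \<le> (\<Sum>k\<le>d'. cmod (Polynomial.coeff p k))"
      by (rule pCons.IH[OF d(2)])
    then show ?thesis
      using * by (simp add: d(1) sum.atMost_Suc_shift del: sum.atMost_Suc)
  qed
qed

text \<open>Every \<open>x\<close> that \<open>u\<close> passes contributes a factor
  \<open>q\<close>, so the coefficient of degree \<open>k\<close> gains \<open>q ^ k\<close>: this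
  is the substitution of \<open>q z\<close> for \<open>z\<close>.\<close>

lemma peval_rotate:
  assumes xu: "x \<in> carrier A" "u \<in> carrier A" and comm: "u \<otimes> x = q \<odot> (x \<otimes> u)"
  shows "u \<otimes> peval p x = peval (pcompose p [:0, q:]) x \<otimes> u"
proof (induction p)
  case (pCons a p)
  let ?p' = "pcompose p [:0, q:]"
  have "u \<otimes> peval (pCons a p) x = a \<odot> u \<oplus> (u \<otimes> x) \<otimes> peval p x"
    using xu by (simp add: peval_pCons mult_add smult_mult_right mult_assoc)
  also have "(u \<otimes> x) \<otimes> peval p x = q \<odot> (x \<otimes> (u \<otimes> peval p x))"
    using xu by (simp add: comm smult_mult_left mult_assoc)
  also have "\<dots> = (q \<odot> (x \<otimes> peval ?p' x)) \<otimes> u"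
    using xu pCons by (simp add: smult_mult_left mult_assoc)
  also have "a \<odot> u \<oplus> \<dots> = peval (pCons a (Polynomial.smult q ?p')) x \<otimes> u"
    using xu by (simp add: peval_pCons peval_smult add_mult smult_mult_left smult_mult_right)
  also have "pCons a (Polynomial.smult q ?p') = pcompose (pCons a p) [:0, q:]"
    by (simp add: pcompose_pCons)
  finally show ?case .
qed (use xu in simp)

text \<open>Conjugation by powers of \<open>u\<close> rotates the argument of a polynomial in \<open>x\<close>, and averaging over
  these rotations kills every non-constant coefficient in the limit.\<close>

lemma norm_coeff_0_le_norm_peval:
  assumes x: "x \<in> carrier A" "\<parallel>x\<parallel> \<le> 1" and u: "unitary A u" "u \<otimes> x = q \<odot> (x \<otimes> u)"
    and q: "cmod q = 1" "\<And>m. 0 < m \<Longrightarrow> q ^ m \<noteq> 1"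
  shows "cmod (Polynomial.coeff p 0) \<le> \<parallel>peval p x\<parallel>"
proof -
  have uA: "u \<in> carrier A" using u by (simp add: unitary_def)
  \<comment> \<open>\<open>R j\<close> evaluated at \<open>x\<close> is the conjugate of
    \<open>p\<close> at \<open>x\<close> by the \<open>j\<close>-th power of \<open>u\<close>;
    \<open>S N\<close> sums the first \<open>N\<close> conjugates.\<close>
  define R where "R j = pcompose p [:0, q ^ j:]" for j
  define S where "S N = (\<Sum>j<N. R j)" for N :: nat
  have coeff_R: "Polynomial.coeff (R j) k = (q ^ k) ^ j * Polynomial.coeff p k" for j k
    by (simp add: R_def coeff_pcompose_linear mult.commute flip: power_mult)
  have R_Suc: "R (Suc j) = pcompose (R j) [:0, q:]" for j
    by (rule poly_eqI) (simp add: coeff_R coeff_pcompose_linear)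
  have norm_R: "\<parallel>peval (R j) x\<parallel> = \<parallel>peval p x\<parallel>" for j
  proof (induction j)
    case 0
    have "R 0 = p" by (rule poly_eqI) (simp add: coeff_R)
    then show ?case by simp
  next
    case (Suc j)
    have "u \<otimes> peval (R j) x = peval (R (Suc j)) x \<otimes> u"
      unfolding R_Suc using peval_rotate x uA u by blast
    then have "\<parallel>peval (R (Suc j)) x\<parallel> = \<parallel>peval (R j) x\<parallel>"
      using norm_mult_unitary_left[OF u(1), of "peval (R j) x"]
        norm_mult_unitary_right[OF u(1), of "peval (R (Suc j)) x"] x by simp
    with Suc show ?case by simp
  qed
  have norm_S: "\<parallel>peval (S N) x\<parallel> \<le> real N * \<parallel>peval p x\<parallel>" for N
  proof (induction N)
    case (Suc N)
    have "\<parallel>peval (S (Suc N)) x\<parallel> \<le> \<parallel>peval (S N) x\<parallel> + \<parallel>peval (R N) x\<parallel>"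
      using x by (simp add: S_def peval_add norm_add)
    with Suc show ?case by (simp add: norm_R algebra_simps)
  qed (simp add: S_def)
  define d where "d = Polynomial.degree p"
  \<comment> \<open>At \<open>k = 0\<close> the quotient is \<open>2 / 0 = 0\<close>, matching the
    vanishing constant coefficient of \<open>Q\<close> below.\<close>
  define D where "D = (\<Sum>k\<le>d. cmod (Polynomial.coeff p k) * (2 / cmod (1 - q ^ k)))"
  have *: "real N * (cmod (Polynomial.coeff p 0) - \<parallel>peval p x\<parallel>) \<le> D" for N
  proof -
    \<comment> \<open>\<open>Q\<close> is the error of the averaging, scaled by \<open>N\<close>.
      Its coefficients are geometric sums times those of \<open>p\<close>, bounded uniformly in
      \<open>N\<close>.\<close>
    define Q where "Q = [:of_nat N * Polynomial.coeff p 0:] - S N"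
    have coeff_S: "Polynomial.coeff (S N) k = Polynomial.coeff p k * (\<Sum>j<N. (q ^ k) ^ j)" for k
      by (simp add: S_def Polynomial.coeff_sum coeff_R sum_distrib_left mult.commute)
    have coeff_Q: "Polynomial.coeff Q k = (if k = 0 then 0 else - Polynomial.coeff (S N) k)" for k
      by (cases k) (simp_all add: Q_def coeff_S)
    have "Polynomial.degree Q \<le> d"
      by (rule degree_le) (simp add: coeff_Q coeff_S d_def Polynomial.coeff_eq_0)
    then have "\<parallel>peval Q x\<parallel> \<le> (\<Sum>k\<le>d. cmod (Polynomial.coeff Q k))"
      by (rule norm_peval_le[OF x])
    also have "\<dots> \<le> D"
      unfolding D_def
    proof (rule sum_mono)
      fix k
      show "cmod (Polynomial.coeff Q k) \<le> cmod (Polynomial.coeff p k) * (2 / cmod (1 - q ^ k))"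
      proof (cases "k = 0")
        case False
        then have "cmod (\<Sum>j<N. (q ^ k) ^ j) \<le> 2 / cmod (1 - q ^ k)"
          using q by (intro norm_geometric_sum_le) (auto simp: norm_power)
        with False show ?thesis
          by (simp only: coeff_Q coeff_S if_False norm_minus_cancel Real_Vector_Spaces.norm_mult)
            (intro mult_left_mono norm_ge_zero)
      qed (simp add: coeff_Q)
    qed
    finally have Q: "\<parallel>peval Q x\<parallel> \<le> D" .
    have "real N * cmod (Polynomial.coeff p 0) = \<parallel>peval (S N + Q) x\<parallel>"
      using x by (simp add: Q_def peval_const norm_smult Real_Vector_Spaces.norm_mult)
    also have "\<dots> \<le> \<parallel>peval (S N) x\<parallel> + \<parallel>peval Q x\<parallel>"
      using x by (simp add: peval_add norm_add)
    finally show ?thesis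
      using Q norm_S[of N] by (simp add: algebra_simps)
  qed
  \<comment> \<open>A positive gap between the two sides, multiplied by a large \<open>N\<close>,
    would exceed the fixed \<open>D\<close>.\<close>
  show ?thesis
  proof (rule ccontr)
    assume "\<not> ?thesis"
    then obtain N where "D < real N * (cmod (Polynomial.coeff p 0) - \<parallel>peval p x\<parallel>)"
      using reals_Archimedean3[of "cmod (Polynomial.coeff p 0) - \<parallel>peval p x\<parallel>"] by auto
    with *[of N] show False by simp
  qed
qed

section \<open>Powers of the sum and their growth\<close>

text \<open>All powers of \<open>u\<close> are collected on the right: in the next multiplication
  \<open>u [^] n\<close> passes one \<open>x\<close> and yields \<open>q ^ n\<close>, hence the new
  factor \<open>[:1, c * q ^ n:]\<close>.\<close>

lemma pow_binomial:
  assumes xu: "x \<in> carrier A" "u \<in> carrier A" and comm: "u \<otimes> x = q \<odot> (x \<otimes> u)"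
  shows "(u \<oplus> c \<odot> (x \<otimes> u)) [^] n = peval (\<Prod>k<n. [:1, c * q ^ k:]) x \<otimes> u [^] n"
proof (induction n)
  case 0
  have "peval 1 x = \<one>"
    using xu peval_const[of x 1] by (simp add: one_pCons)
  then show ?case by simp
next
  case (Suc n)
  have pow_comm: "u [^] n \<otimes> x = q ^ n \<odot> (x \<otimes> u [^] n)"
  proof (induction n)
    case (Suc n)
    have "u [^] Suc n \<otimes> x = u [^] n \<otimes> (q \<odot> (x \<otimes> u))"
      using xu comm by (simp add: mult_assoc)
    also have "\<dots> = q \<odot> ((u [^] n \<otimes> x) \<otimes> u)"
      using xu by (simp add: smult_mult_right mult_assoc)
    also have "\<dots> = q ^ Suc n \<odot> (x \<otimes> u [^] Suc n)"
      using xu Suc by (simp add: smult_mult_left smult_assoc mult_assoc)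
    finally show ?case .
  qed (use xu in simp)
  define E where "E = peval (\<Prod>k<n. [:1, c * q ^ k:]) x"
  have E: "E \<in> carrier A" using xu by (simp add: E_def)
  have "(u \<oplus> c \<odot> (x \<otimes> u)) [^] Suc n = E \<otimes> u [^] n \<otimes> (u \<oplus> c \<odot> (x \<otimes> u))"
    using Suc by (simp add: E_def)
  also have "\<dots> = E \<otimes> u [^] Suc n \<oplus> c \<odot> (E \<otimes> ((u [^] n \<otimes> x) \<otimes> u))"
    using xu E by (simp add: mult_add smult_mult_right mult_assoc)
  also have "\<dots> = (E \<oplus> (c * q ^ n) \<odot> (E \<otimes> x)) \<otimes> u [^] Suc n"
    using xu E by (simp add: pow_comm add_mult smult_mult_left smult_mult_right smult_assoc mult_assoc)
  also have "E \<oplus> (c * q ^ n) \<odot> (E \<otimes> x) = peval (\<Prod>k<Suc n. [:1, c * q ^ k:]) x"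
    using xu by (simp only: prod.lessThan_Suc peval_mult_linear E_def)
  finally show ?case .
qed

lemma spectral_radius_rotation_pair:
  assumes x: "unitary A x" and u: "unitary A u" and comm: "u \<otimes> x = q \<odot> (x \<otimes> u)"
    and q: "cmod q = 1" "\<And>m. 0 < m \<Longrightarrow> q ^ m \<noteq> 1" and lam: "0 \<le> lam" "lam \<le> 1"
  shows "spectral_radius A (u \<oplus> complex_of_real lam \<odot> (x \<otimes> u)) = 1"
proof -
  have xA: "x \<in> carrier A" "\<parallel>x\<parallel> \<le> 1" and uA: "u \<in> carrier A"
    using x u norm_unitary by (auto simp: unitary_def)
  define P where "P n = (\<Prod>k<n. [:1, complex_of_real lam * q ^ k:])" for n :: nat
  \<comment> \<open>The right factor \<open>u [^] n\<close> does not change the norm.\<close>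
  have norm_pow: "\<parallel>(u \<oplus> complex_of_real lam \<odot> (x \<otimes> u)) [^] n\<parallel> = \<parallel>peval (P n) x\<parallel>" for n :: nat
    using pow_binomial[OF xA(1) uA comm, of "complex_of_real lam" n]
      norm_mult_unitary_pow_right[OF u, of "peval (P n) x" n] xA by (simp add: P_def)
  have "(\<lambda>n. root n \<parallel>peval (P n) x\<parallel>) \<longlonglongrightarrow> 1"
  proof (rule root_tendsto_1)
    fix n
    have "Polynomial.coeff (P n) 0 = 1"
      by (simp add: P_def poly_prod flip: poly_0_coeff_0)
    then show "1 \<le> \<parallel>peval (P n) x\<parallel>"
      using norm_coeff_0_le_norm_peval[OF xA u comm q, of "P n"] by simp
  next
    fix e :: real
    assume "0 < e"
    then obtain C where C: "0 < C"
      "\<And>n z. cmod z = 1 \<Longrightarrow> (\<Prod>k<n. cmod (1 + of_real lam * q ^ k * z)) \<le> C * exp (e * real n)"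
      using rotation_product_subexponential[OF q lam] by blast
    have "\<parallel>peval (P n) x\<parallel> \<le> real (Suc n) * C * exp (e * real n)" for n
    proof -
      have "Polynomial.degree (P n) \<le> (\<Sum>k<n. Polynomial.degree [:1, complex_of_real lam * q ^ k:])"
        unfolding P_def by (rule degree_prod_sum_le[unfolded o_def]) simp
      also have "\<dots> \<le> (\<Sum>k<n. 1)"
        by (intro sum_mono) simp
      finally have "Polynomial.degree (P n) \<le> n" by simp
      then have "\<parallel>peval (P n) x\<parallel> \<le> (\<Sum>k\<le>n. cmod (Polynomial.coeff (P n) k))"
        by (rule norm_peval_le[OF xA])
      \<comment> \<open>On the unit circle \<open>P n\<close> has modulus equal to the rotation
        product, so its bound holds for each of the \<open>Suc n\<close> coefficients.\<close>
      also have "\<dots> \<le> (\<Sum>k\<le>n. C * exp (e * real n))"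
        using C(2)[of _ n]
        by (intro sum_mono norm_coeff_le_circle_bound)
          (simp add: P_def poly_prod mult_ac flip: prod_norm)
      finally show ?thesis by simp
    qed
    with C(1) show "\<exists>C>0. \<forall>n. \<parallel>peval (P n) x\<parallel> \<le> real (Suc n) * C * exp (e * real n)"
      by blast
  qed
  then show ?thesis
    unfolding spectral_radius_def norm_pow by (rule limI)
qed

end

section \<open>The irrational rotation algebra\<close>

text \<open>Otherwise \<open>m\<close> times \<theta> would be an integer.\<close>

lemma irrational_rotation_not_root_of_unity:
  assumes "\<theta> \<notin> \<rat>" "0 < m"
  shows "exp (2 * of_real pi * \<i> * of_real \<theta>) ^ m \<noteq> 1"
proof
  assume "exp (2 * of_real pi * \<i> * of_real \<theta>) ^ m = 1"
  then have "exp (of_nat m * (2 * of_real pi * \<i> * of_real \<theta>)) = 1"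
    by (simp only: exp_of_nat_mult)
  then obtain n :: int where "real m * (2 * pi * \<theta>) = of_int (2 * n) * pi"
    by (auto simp: exp_eq_1)
  then have "\<theta> = of_int n / of_nat m"
    using \<open>0 < m\<close> by (simp add: field_simps)
  then show False
    using \<open>\<theta> \<notin> \<rat>\<close> by auto
qed

theorem lemma9p5:
  fixes \<theta> lam :: real and A :: "'a cstar" and u v :: 'a
  assumes "0 < \<theta>" and "\<theta> < 1" and "\<theta> \<notin> \<rat>"
    and "universal_rotation_algebra \<theta> A u v"
    and "0 < lam" and "lam \<le> 1"
  shows "spectral_radius A (u \<oplus>\<^bsub>A\<^esub> (complex_of_real lam \<odot>\<^bsub>A\<^esub> v)) = 1"
proof -
  interpret unital_cstar_algebra A
    using assms by (simp add: universal_rotation_algebra_def)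
  \<comment> \<open>This is the inverse of the \<open>q\<close> in the overview; the general result
    is applied with \<open>inverse q\<close>.\<close>
  define q where "q = exp (2 * of_real pi * \<i> * of_real \<theta>)"
  have u: "unitary A u" and v: "unitary A v"
    and vu: "v \<otimes>\<^bsub>A\<^esub> u = q \<odot>\<^bsub>A\<^esub> (u \<otimes>\<^bsub>A\<^esub> v)"
    using assms by (auto simp: universal_rotation_algebra_def rotation_pair_def q_def)
  have norm_q: "cmod q = 1"
    by (simp add: q_def norm_exp_eq_Re)
  then have "q \<noteq> 0" by auto
  define x where "x = v \<otimes>\<^bsub>A\<^esub> u\<star>\<^bsub>A\<^esub>"
  have carrier: "u \<in> carrier A" "v \<in> carrier A" "u\<star>\<^bsub>A\<^esub> \<in> carrier A" "v\<star>\<^bsub>A\<^esub> \<in> carrier A"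
    and uni: "u\<star>\<^bsub>A\<^esub> \<otimes>\<^bsub>A\<^esub> u = \<one>\<^bsub>A\<^esub>" "u \<otimes>\<^bsub>A\<^esub> u\<star>\<^bsub>A\<^esub> = \<one>\<^bsub>A\<^esub>"
      "v\<star>\<^bsub>A\<^esub> \<otimes>\<^bsub>A\<^esub> v = \<one>\<^bsub>A\<^esub>" "v \<otimes>\<^bsub>A\<^esub> v\<star>\<^bsub>A\<^esub> = \<one>\<^bsub>A\<^esub>"
    using u v star_closed by (auto simp: unitary_def)
  have xu: "x \<otimes>\<^bsub>A\<^esub> u = v"
    using carrier uni by (simp add: x_def mult_assoc)
  have x: "unitary A x"
  proof -
    have "x\<star>\<^bsub>A\<^esub> = u \<otimes>\<^bsub>A\<^esub> v\<star>\<^bsub>A\<^esub>"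
      using carrier by (simp add: x_def star_mult star_star)
    moreover have "u \<otimes>\<^bsub>A\<^esub> v\<star>\<^bsub>A\<^esub> \<otimes>\<^bsub>A\<^esub> (v \<otimes>\<^bsub>A\<^esub> u\<star>\<^bsub>A\<^esub>)
        = u \<otimes>\<^bsub>A\<^esub> (v\<star>\<^bsub>A\<^esub> \<otimes>\<^bsub>A\<^esub> v) \<otimes>\<^bsub>A\<^esub> u\<star>\<^bsub>A\<^esub>"
      "v \<otimes>\<^bsub>A\<^esub> u\<star>\<^bsub>A\<^esub> \<otimes>\<^bsub>A\<^esub> (u \<otimes>\<^bsub>A\<^esub> v\<star>\<^bsub>A\<^esub>)
        = v \<otimes>\<^bsub>A\<^esub> (u\<star>\<^bsub>A\<^esub> \<otimes>\<^bsub>A\<^esub> u) \<otimes>\<^bsub>A\<^esub> v\<star>\<^bsub>A\<^esub>"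
      using carrier by (simp_all add: mult_assoc)
    ultimately show ?thesis
      using carrier uni by (simp add: unitary_def x_def)
  qed
  \<comment> \<open>Multiplying this relation by the adjoint of \<open>u\<close> on the right turns
    \<open>u v\<close> into \<open>u x\<close>, and \<open>v u\<close> into \<open>v\<close>, which
    is \<open>x u\<close>.\<close>
  have "inverse q \<odot>\<^bsub>A\<^esub> (v \<otimes>\<^bsub>A\<^esub> u) = u \<otimes>\<^bsub>A\<^esub> v"
    using carrier \<open>q \<noteq> 0\<close> by (simp add: vu smult_assoc)
  then have "u \<otimes>\<^bsub>A\<^esub> x = inverse q \<odot>\<^bsub>A\<^esub> (v \<otimes>\<^bsub>A\<^esub> u) \<otimes>\<^bsub>A\<^esub> u\<star>\<^bsub>A\<^esub>"
    using carrier by (simp add: x_def mult_assoc)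
  also have "\<dots> = inverse q \<odot>\<^bsub>A\<^esub> (x \<otimes>\<^bsub>A\<^esub> u)"
    using carrier uni xu by (simp add: smult_mult_left mult_assoc)
  finally have comm: "u \<otimes>\<^bsub>A\<^esub> x = inverse q \<odot>\<^bsub>A\<^esub> (x \<otimes>\<^bsub>A\<^esub> u)" .
  have "inverse q ^ m \<noteq> 1" if "0 < m" for m
    using irrational_rotation_not_root_of_unity[OF assms(3) that]
    by (simp add: q_def power_inverse)
  then show ?thesis
    using spectral_radius_rotation_pair[OF x u comm _ _ less_imp_le[OF assms(5)] assms(6)] norm_q
    by (simp add: xu norm_inverse)
qed

end
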